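(* Let $n,s\ge 1$ be integers, and let $\mathcal{A}\subset\mathbb{R}^n$ be an affine subspace of dimension $r$. Let $\bm{X}\in\mathbb{R}^{n\times s}$ be a real matrix each of whose columns belongs to $\mathcal{A}$. Then $$\operatorname{rank}\,\phi_d(\bm{X})\le \binom{r+d}{d}\qquad\text{for all integers } d\ge 1.$$
   Context: For a vector $\bm{x}=(x_1,\dots,x_n)\in\mathbb{R}^n$ and an integer $d\ge 1$, $\phi_d(\bm{x})=(\bm{x}^{\bm{\alpha}})_{|\bm{\alpha}|\le d}\in\mathbb{R}^N$ is the vector of all monomials in $x_1,\dots,x_n$ of degree at most $d$. Here $\bm{\alpha}=(\alpha_1,\dots,\alpha_n)$ ranges over multi-indices of non-negative integers with $|\bm{\alpha}|:=\alpha_1+\cdots+\alpha_n\le d$, $\bm{x}^{\bm{\alpha}}:=x_1^{\alpha_1}\cdots x_n^{\alpha_n}$, and $N=\binom{n+d}{d}$. For a matrix $\bm{X}=[\bm{x}_1,\dots,\bm{x}_s]\in\mathbb{R}^{n\times s}$ with columns $\bm{x}_i$, $\phi_d(\bm{X})$ denotes the $N\times s$ real matrix $[\phi_d(\bm{x}_1),\dots,\phi_d(\bm{x}_s)]$. Affine subspaces are nonempty translates of linear subspaces. *)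

theory Defs
  imports "Jordan_Normal_Form.DL_Rank"
begin

(* Exponent vectors of the monomials in n variables of degree at most d, as lists of length n,
   in lexicographic order. The order only fixes the order of the rows of phi_mat, which does
   not affect its rank. *)
fun multi_indices :: "nat \<Rightarrow> nat \<Rightarrow> nat list list" where
  "multi_indices 0 d = [[]]"
| "multi_indices (Suc n) d =
     concat (map (\<lambda>k. map ((#) k) (multi_indices n (d - k))) [0..<Suc d])"

lemma set_multi_indices:
  "set (multi_indices n d) = {\<alpha>. length \<alpha> = n \<and> sum_list \<alpha> \<le> d}"
proof (induction n arbitrary: d)
  case 0
  then show ?case by auto
next
  case (Suc n)
  show ?case
  proof (intro Set.set_eqI iffI)
    fix \<alpha> assume "\<alpha> \<in> set (multi_indices (Suc n) d)"
    then show "\<alpha> \<in> {\<alpha>. length \<alpha> = Suc n \<and> sum_list \<alpha> \<le> d}"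
      by (auto simp: Suc.IH simp del: upt_Suc)
  next
    fix \<alpha> assume "\<alpha> \<in> {\<alpha>. length \<alpha> = Suc n \<and> sum_list \<alpha> \<le> d}"
    then obtain k \<beta> where "\<alpha> = k # \<beta>" "length \<beta> = n" "k + sum_list \<beta> \<le> d"
      by (cases \<alpha>) auto
    then have "k \<in> set [0..<Suc d]" and "\<beta> \<in> set (multi_indices n (d - k))"
      by (auto simp: Suc.IH)
    with \<open>\<alpha> = k # \<beta>\<close> show "\<alpha> \<in> set (multi_indices (Suc n) d)"
      by (auto simp del: upt_Suc)
  qed
qed

lemma length_multi_indices: "length (multi_indices n d) = (n + d) choose d"
proof (induction n arbitrary: d)
  case 0
  then show ?case by simp
next
  case (Suc n)
  have "length (multi_indices (Suc n) d) = (\<Sum>k<Suc d. (n + (d - k)) choose (d - k))"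
    by (simp add: length_concat comp_def Suc.IH interv_sum_list_conv_sum_set_nat
        atLeast0LessThan del: upt_Suc)
  also have "\<dots> = (\<Sum>k\<le>d. (n + k) choose k)"
    unfolding lessThan_Suc_atMost
    by (rule sum.reindex_bij_witness[of _ "\<lambda>k. d - k" "\<lambda>k. d - k"]) auto
  also have "\<dots> = (Suc n + d) choose d"
    by (simp add: sum_choose_lower)
  finally show ?case .
qed

lemma distinct_multi_indices: "distinct (multi_indices n d)"
proof (induction n arbitrary: d)
  case 0
  then show ?case by simp
next
  case (Suc n)
  have concat: "distinct (concat (map (\<lambda>k. map ((#) k) (multi_indices n (e k))) ks))"
    if "distinct ks" for e and ks :: "nat list"
    using that by (induction ks) (auto simp: distinct_map Suc.IH)
  show ?case
    unfolding multi_indices.simps by (rule concat[OF distinct_upt])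
qed

definition monomial_value :: "nat list \<Rightarrow> real vec \<Rightarrow> real" where
  "monomial_value \<alpha> x = (\<Prod>j<length \<alpha>. (x $ j) ^ (\<alpha> ! j))"

definition phi_vec :: "nat \<Rightarrow> nat \<Rightarrow> real vec \<Rightarrow> real vec" where
  "phi_vec n d x = vec ((n + d) choose d) (\<lambda>i. monomial_value (multi_indices n d ! i) x)"

definition phi_mat :: "nat \<Rightarrow> nat \<Rightarrow> real mat \<Rightarrow> real mat" where
  "phi_mat n d X = mat_of_cols ((n + d) choose d) (map (phi_vec n d) (cols X))"

(* A is a translate v + W of a linear subspace W of R^n, and r = dim W.
   Such a set is automatically nonempty, and W (hence r) is determined by A. *)
definition affine_subspace :: "nat \<Rightarrow> nat \<Rightarrow> real vec set \<Rightarrow> bool" where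
  "affine_subspace n r A \<longleftrightarrow>
     (\<exists>v W. v \<in> carrier_vec n \<and>
        subspace class_ring W (module_vec TYPE(real) n) \<and>
        vectorspace.dim class_ring ((module_vec TYPE(real) n)\<lparr>carrier := W\<rparr>) = r \<and>
        A = (\<lambda>w. v + w) ` W)"

end

theory Submission
  imports Defs
begin

text \<open>Parametrise \<open>A\<close> by affine coordinates \<open>y\<close> in \<open>\<real>\<^sup>r\<close>. A monomial of degree at most
  \<open>d\<close> in \<open>x = v + M y\<close> is a polynomial of degree at most \<open>d\<close> in \<open>y\<close>, so \<open>\<phi>\<^sub>d(X)\<close> factors through
  the space of real vectors indexed by the monomials in \<open>r\<close> variables of degree at most \<open>d\<close>.\<close>

section \<open>Linear algebra: a rank bound, bases and affine coordinates\<close>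

context vec_space
begin

text \<open>The columns of \<open>A\<close> lie in the column space of \<open>T\<close>, which at
  most \<open>m\<close> vectors span, so Steinitz exchange bounds any independent set of them.
  Stating the factorization column by column avoids assembling the vectors \<open>y\<close> into a
  matrix.\<close>

lemma rank_le_dim_col_factor:
  assumes A: "A \<in> carrier_mat n nc" and T: "T \<in> carrier_mat n m"
    and factor: "\<And>a. a \<in> set (cols A) \<Longrightarrow> \<exists>y\<in>carrier_vec m. a = T *\<^sub>v y"
  shows "rank A \<le> m"
proof -
  have TV: "set (cols T) \<subseteq> carrier_vec n"
    using T cols_dim by blast
  \<comment> \<open>The rank of \<open>A\<close> is the size of any maximal independent set of
    columns; one is grown from the empty set.\<close>
  obtain S where S: "finite S" "maximal S (\<lambda>S. S \<subseteq> set (cols A) \<and> lin_indpt S)"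
    using maximal_exists_superset[of "set (cols A)" "\<lambda>S. S \<subseteq> set (cols A) \<and> lin_indpt S" "{}"]
    by (auto simp: lin_dep_def)
  then have li: "lin_indpt S" and sub: "S \<subseteq> set (cols A)"
    by (auto simp: maximal_def)
  have SV: "S \<subseteq> carrier_vec n"
    using sub A cols_dim by blast
  have "S \<subseteq> span (set (cols T))"
    using sub factor T SV col_space_eq[OF T] unfolding col_space_def by force
  then have "card S \<le> card (set (cols T))"
    using replacement[of S "set (cols T)"] S(1) li SV TV by force
  \<comment> \<open>Only an inequality, since repeated columns of \<open>T\<close> collapse in the
    set.\<close>
  also have "\<dots> \<le> m"
    using card_length[of "cols T"] T by simp
  finally show ?thesis
    using rank_card_indpt[OF A S(2)] by simp
qed

text \<open>The columns of \<open>M\<close> are a basis of \<open>W\<close>, so \<open>y\<close> is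
  the coordinate vector of \<open>w\<close>.\<close>

lemma subspace_basis_mat:
  assumes W: "subspace class_ring W V"
    and dim: "vectorspace.dim class_ring (V\<lparr>carrier := W\<rparr>) = r"
  obtains M where "M \<in> carrier_mat n r"
    and "\<And>w. w \<in> W \<Longrightarrow> \<exists>y\<in>carrier_vec r. w = M *\<^sub>v y"
proof -
  have sm: "submodule class_ring W V"
    using W by (simp add: subspace_def)
  have WV: "W \<subseteq> carrier_vec n"
    using sm by (auto simp: submodule_def)
  interpret W: vectorspace class_ring "V\<lparr>carrier := W\<rparr>"
    by (rule subspace_is_vs[OF W])
  \<comment> \<open>Independence in \<open>W\<close> as a space of its own agrees with independence
    in the ambient space, so \<open>n\<close> bounds the size of independent subsets of
    \<open>W\<close> and a maximal one exists.\<close>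
  have small: "finite S \<and> card S \<le> n" if "S \<subseteq> W \<and> W.lin_indpt S" for S
    using li_le_dim[of S] that span_li_not_depend(2)[OF _ sm, of S] WV dim_is_n by auto
  have empty: "W.lin_indpt {}"
    by (auto simp: W.lin_dep_def)
  obtain B where B: "finite B" "maximal B (\<lambda>S. S \<subseteq> W \<and> W.lin_indpt S)"
    using maximal_exists[of "\<lambda>S. S \<subseteq> W \<and> W.lin_indpt S" n "{}"] small empty by blast
  have basis: "W.basis B"
    using B(2) by (intro W.max_li_is_basis) simp
  have card: "card B = r"
    using W.dim_basis[OF B(1) basis] dim by simp
  have BW: "B \<subseteq> W"
    using B(2) by (auto simp: maximal_def)
  have span: "span B = W"
    using basis span_li_not_depend(1)[OF BW sm] by (simp add: W.basis_def)
  \<comment> \<open>Columns need an order; distinctness makes their number exactly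
    \<open>r\<close>.\<close>
  obtain bs where bs: "set bs = B" "distinct bs"
    using finite_distinct_list[OF B(1)] by blast
  define M where "M = mat_of_cols n bs"
  have M: "M \<in> carrier_mat n r"
    using bs card distinct_card[OF bs(2)] by (simp add: M_def)
  have cols: "cols M = bs"
    using bs BW WV by (auto simp: M_def)
  have "\<exists>y\<in>carrier_vec r. w = M *\<^sub>v y" if "w \<in> W" for w
    using that span cols bs col_space_eq[OF M] M unfolding col_space_def by auto
  then show thesis
    using that[OF M] by blast
qed

end

lemma affine_subspace_parametrization:
  assumes "affine_subspace n r A"
  obtains v M where "v \<in> carrier_vec n" and "M \<in> carrier_mat n r"
    and "\<And>x. x \<in> A \<Longrightarrow> \<exists>y\<in>carrier_vec r. x = v + M *\<^sub>v y"
proof -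
  obtain v W where v: "v \<in> carrier_vec n"
    and W: "subspace class_ring W (module_vec TYPE(real) n)"
    and dim: "vectorspace.dim class_ring ((module_vec TYPE(real) n)\<lparr>carrier := W\<rparr>) = r"
    and A: "A = (\<lambda>w. v + w) ` W"
    using assms unfolding affine_subspace_def by blast
  obtain M where "M \<in> carrier_mat n r"
    and "\<And>w. w \<in> W \<Longrightarrow> \<exists>y\<in>carrier_vec r. w = M *\<^sub>v y"
    using vec_space.subspace_basis_mat[OF W dim] by metis
  with v A show thesis
    by (intro that[of v M]) auto
qed

section \<open>Functions given on \<open>carrier_vec r\<close> by polynomials of degree at most
  \<open>d\<close>\<close>

definition poly_function :: "nat \<Rightarrow> nat \<Rightarrow> (real vec \<Rightarrow> real) \<Rightarrow> bool" where
  "poly_function r d f \<longleftrightarrow>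
     (\<exists>c. \<forall>y\<in>carrier_vec r. f y = (\<Sum>\<alpha>\<in>set (multi_indices r d). c \<alpha> * monomial_value \<alpha> y))"

text \<open>Values outside \<open>carrier_vec r\<close> do not matter, so expansions valid only for
  vectors of length \<open>r\<close> can be substituted.\<close>

lemma poly_function_cong:
  assumes "\<And>y. y \<in> carrier_vec r \<Longrightarrow> f y = g y"
  shows "poly_function r d f \<longleftrightarrow> poly_function r d g"
  using assms by (simp add: poly_function_def)

lemma poly_function_monomial:
  assumes "length \<alpha> = r" and "sum_list \<alpha> \<le> d"
  shows "poly_function r d (monomial_value \<alpha>)"
proof -
  let ?c = "\<lambda>\<beta>. if \<beta> = \<alpha> then 1 else 0 :: real"
  have \<alpha>: "\<alpha> \<in> set (multi_indices r d)"
    using assms by (simp add: set_multi_indices)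
  have "(\<Sum>\<beta>\<in>set (multi_indices r d). ?c \<beta> * monomial_value \<beta> y) =
      (\<Sum>\<beta>\<in>set (multi_indices r d). if \<beta> = \<alpha> then monomial_value \<beta> y else 0)" for y
    by (intro sum.cong) auto
  then have "(\<Sum>\<beta>\<in>set (multi_indices r d). ?c \<beta> * monomial_value \<beta> y) = monomial_value \<alpha> y" for y
    using \<alpha> by simp
  then show ?thesis
    unfolding poly_function_def by (intro exI[of _ ?c]) simp
qed

lemma poly_function_add:
  assumes "poly_function r d f" and "poly_function r d g"
  shows "poly_function r d (\<lambda>y. f y + g y)"
proof -
  obtain a b where
    "\<forall>y\<in>carrier_vec r. f y = (\<Sum>\<alpha>\<in>set (multi_indices r d). a \<alpha> * monomial_value \<alpha> y)"
    "\<forall>y\<in>carrier_vec r. g y = (\<Sum>\<alpha>\<in>set (multi_indices r d). b \<alpha> * monomial_value \<alpha> y)"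
    using assms unfolding poly_function_def by blast
  then show ?thesis
    unfolding poly_function_def
    by (intro exI[of _ "\<lambda>\<alpha>. a \<alpha> + b \<alpha>"]) (simp add: sum.distrib distrib_right)
qed

lemma poly_function_scale:
  assumes "poly_function r d f"
  shows "poly_function r d (\<lambda>y. k * f y)"
proof -
  obtain a where
    "\<forall>y\<in>carrier_vec r. f y = (\<Sum>\<alpha>\<in>set (multi_indices r d). a \<alpha> * monomial_value \<alpha> y)"
    using assms unfolding poly_function_def by blast
  then show ?thesis
    unfolding poly_function_def
    by (intro exI[of _ "\<lambda>\<alpha>. k * a \<alpha>"]) (simp add: sum_distrib_left mult.assoc)
qed

lemma poly_function_const: "poly_function r d (\<lambda>_. k)"
  \<comment> \<open>The zero exponent vector gives the monomial 1.\<close>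
  using poly_function_scale[OF poly_function_monomial[of "replicate r 0" r d], of k]
  by (simp add: monomial_value_def sum_list_replicate)

lemma poly_function_sum:
  assumes "\<And>i. i \<in> I \<Longrightarrow> poly_function r d (f i)"
  shows "poly_function r d (\<lambda>y. \<Sum>i\<in>I. f i y)"
  using assms
  by (induction I rule: infinite_finite_induct)
    (simp_all add: poly_function_add poly_function_const)

lemma poly_function_mono:
  assumes "poly_function r d f" and "d \<le> e"
  shows "poly_function r e f"
proof -
  obtain a where a:
    "\<And>y. y \<in> carrier_vec r \<Longrightarrow>
       f y = (\<Sum>\<alpha>\<in>set (multi_indices r d). a \<alpha> * monomial_value \<alpha> y)"
    using assms unfolding poly_function_def by blast
  \<comment> \<open>Rather than padding the coefficients with zeros, the same sum is rebuilt in
    degree \<open>e\<close> from the closure lemmas.\<close>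
  have "poly_function r e (\<lambda>y. \<Sum>\<alpha>\<in>set (multi_indices r d). a \<alpha> * monomial_value \<alpha> y)"
    using assms(2)
    by (intro poly_function_sum poly_function_scale poly_function_monomial)
      (auto simp: set_multi_indices)
  then show ?thesis
    using poly_function_cong[of r f, OF a] by blast
qed

lemma sum_list_map2_plus:
  fixes xs ys :: "nat list"
  assumes "length xs = length ys"
  shows "sum_list (map2 (+) xs ys) = sum_list xs + sum_list ys"
  using assms by (induction xs ys rule: list_induct2) auto

text \<open>Exponents add. Equal lengths matter because \<open>map2\<close> truncates to the shorter
  list.\<close>

lemma monomial_value_mult:
  assumes "length \<alpha> = length \<beta>"
  shows "monomial_value \<alpha> y * monomial_value \<beta> y = monomial_value (map2 (+) \<alpha> \<beta>) y"
  using assms by (simp add: monomial_value_def power_add prod.distrib)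

lemma poly_function_mult:
  assumes "poly_function r d f" and "poly_function r e g"
  shows "poly_function r (d + e) (\<lambda>y. f y * g y)"
proof -
  obtain a b where
    a: "\<And>y. y \<in> carrier_vec r \<Longrightarrow>
          f y = (\<Sum>\<alpha>\<in>set (multi_indices r d). a \<alpha> * monomial_value \<alpha> y)" and
    b: "\<And>y. y \<in> carrier_vec r \<Longrightarrow>
          g y = (\<Sum>\<beta>\<in>set (multi_indices r e). b \<beta> * monomial_value \<beta> y)"
    using assms unfolding poly_function_def by blast
  have eq: "f y * g y =
      (\<Sum>\<alpha>\<in>set (multi_indices r d). \<Sum>\<beta>\<in>set (multi_indices r e).
         (a \<alpha> * b \<beta>) * monomial_value (map2 (+) \<alpha> \<beta>) y)" if "y \<in> carrier_vec r" for y
    unfolding a[OF that] b[OF that] sum_product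
  proof (intro sum.cong refl)
    fix \<alpha> \<beta>
    assume "\<alpha> \<in> set (multi_indices r d)" "\<beta> \<in> set (multi_indices r e)"
    then have "monomial_value (map2 (+) \<alpha> \<beta>) y = monomial_value \<alpha> y * monomial_value \<beta> y"
      by (intro monomial_value_mult[symmetric]) (simp add: set_multi_indices)
    then show "a \<alpha> * monomial_value \<alpha> y * (b \<beta> * monomial_value \<beta> y) =
        (a \<alpha> * b \<beta>) * monomial_value (map2 (+) \<alpha> \<beta>) y"
      by simp
  qed
  \<comment> \<open>Different pairs may give the same exponent vector; closure under sums takes care
    of collecting like terms.\<close>
  have "poly_function r (d + e)
      (\<lambda>y. \<Sum>\<alpha>\<in>set (multi_indices r d). \<Sum>\<beta>\<in>set (multi_indices r e).
         (a \<alpha> * b \<beta>) * monomial_value (map2 (+) \<alpha> \<beta>) y)"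
    by (intro poly_function_sum poly_function_scale poly_function_monomial)
      (auto simp: set_multi_indices sum_list_map2_plus)
  then show ?thesis
    using poly_function_cong[of r "\<lambda>y. f y * g y", OF eq] by blast
qed

lemma poly_function_power:
  assumes "poly_function r d f"
  shows "poly_function r (d * k) (\<lambda>y. f y ^ k)"
proof (induction k)
  case 0
  show ?case
    by (simp add: poly_function_const)
next
  case (Suc k)
  then show ?case
    using poly_function_mult[OF assms Suc] by simp
qed

text \<open>The degree bound may vary with the factor, so in a monomial each coordinate power can
  contribute its own exponent. For infinite \<open>I\<close> the bound is 0 and the product is 1, a
  constant.\<close>

lemma poly_function_prod:
  assumes "\<And>i. i \<in> I \<Longrightarrow> poly_function r (d i) (f i)"
  shows "poly_function r (\<Sum>i\<in>I. d i) (\<lambda>y. \<Prod>i\<in>I. f i y)"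
  using assms
  by (induction I rule: infinite_finite_induct)
    (simp_all add: poly_function_mult poly_function_const)

lemma poly_function_coordinate:
  assumes "j < r"
  shows "poly_function r 1 (\<lambda>y. y $ j)"
proof -
  let ?e = "(replicate r 0)[j := Suc 0]"
  have "monomial_value ?e y = (\<Prod>i<r. if i = j then y $ j else 1)" for y
    unfolding monomial_value_def using assms
    by (intro prod.cong) (auto simp: nth_list_update)
  then have "monomial_value ?e = (\<lambda>y. y $ j)"
    using assms by auto
  moreover have "sum_list ?e = 1"
    using assms by (simp add: sum_list_update sum_list_replicate)
  ultimately show ?thesis
    using poly_function_monomial[of ?e r 1] by simp
qed

section \<open>Affine substitution into monomials\<close>

lemma poly_function_affine:
  assumes "M \<in> carrier_mat n r" and "v \<in> carrier_vec n" and "i < n"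
  shows "poly_function r 1 (\<lambda>y. (v + M *\<^sub>v y) $ i)"
proof -
  have eq: "(v + M *\<^sub>v y) $ i = v $ i + (\<Sum>j<r. M $$ (i, j) * y $ j)"
    if "y \<in> carrier_vec r" for y
    using that assms by (auto simp: scalar_prod_def atLeast0LessThan)
  have "poly_function r 1 (\<lambda>y. v $ i + (\<Sum>j<r. M $$ (i, j) * y $ j))"
    by (intro poly_function_add poly_function_const poly_function_sum poly_function_scale
        poly_function_coordinate) auto
  then show ?thesis
    using poly_function_cong[of r "\<lambda>y. (v + M *\<^sub>v y) $ i", OF eq] by blast
qed

text \<open>Each coordinate of \<open>v + M *\<^sub>v y\<close> has degree at most 1 in
  \<open>y\<close>, so its power has degree at most the exponent, and the degrees of the factors add
  up to at most \<open>sum_list \<alpha>\<close>.\<close>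

lemma poly_function_monomial_affine:
  assumes "M \<in> carrier_mat n r" and "v \<in> carrier_vec n"
    and "length \<alpha> = n" and "sum_list \<alpha> \<le> d"
  shows "poly_function r d (\<lambda>y. monomial_value \<alpha> (v + M *\<^sub>v y))"
proof -
  \<comment> \<open>The factor 1 is the degree bound of a coordinate, in the form
    \<open>poly_function_power\<close> produces.\<close>
  have "poly_function r (\<Sum>i<n. 1 * \<alpha> ! i) (\<lambda>y. \<Prod>i<n. ((v + M *\<^sub>v y) $ i) ^ (\<alpha> ! i))"
    by (intro poly_function_prod poly_function_power
        poly_function_affine[OF assms(1,2)]) simp
  moreover have "(\<Sum>i<n. 1 * \<alpha> ! i) = sum_list \<alpha>"
    using assms(3) by (simp add: sum_list_sum_nth atLeast0LessThan)
  ultimately show ?thesis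
    using poly_function_mono assms(3,4) by (simp add: monomial_value_def)
qed

text \<open>Row \<open>i\<close> of \<open>T\<close> holds the coefficients of the
  \<open>i\<close>-th monomial of the affine image, expanded in \<open>y\<close>. Thus
  \<open>T\<close> depends on \<open>v\<close>, \<open>M\<close> and \<open>d\<close> but not on
  \<open>y\<close>: the substitution is linear on vectors of monomials.\<close>

lemma phi_vec_affine:
  assumes "M \<in> carrier_mat n r" and "v \<in> carrier_vec n"
  obtains T where "T \<in> carrier_mat ((n + d) choose d) ((r + d) choose d)"
    and "\<And>y. y \<in> carrier_vec r \<Longrightarrow> phi_vec n d (v + M *\<^sub>v y) = T *\<^sub>v phi_vec r d y"
proof -
  let ?N = "(n + d) choose d" and ?R = "(r + d) choose d"
  have "poly_function r d (\<lambda>y. monomial_value (multi_indices n d ! i) (v + M *\<^sub>v y))"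
    if "i < ?N" for i
  proof -
    have "multi_indices n d ! i \<in> set (multi_indices n d)"
      using that by (simp add: length_multi_indices)
    then show ?thesis
      by (intro poly_function_monomial_affine[OF assms]) (auto simp: set_multi_indices)
  qed
  \<comment> \<open>Choice gives one coefficient family per row, uniform in
    \<open>y\<close>.\<close>
  then obtain c where c: "\<And>i y. i < ?N \<Longrightarrow> y \<in> carrier_vec r \<Longrightarrow>
      monomial_value (multi_indices n d ! i) (v + M *\<^sub>v y) =
        (\<Sum>\<alpha>\<in>set (multi_indices r d). c i \<alpha> * monomial_value \<alpha> y)"
    unfolding poly_function_def by metis
  define T where "T = mat ?N ?R (\<lambda>(i, k). c i (multi_indices r d ! k))"
  \<comment> \<open>Since the list has no repetitions, a sum over exponent vectors is a sum over
    positions, as in a matrix-vector product.\<close>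
  have sum_nth: "(\<Sum>\<alpha>\<in>set (multi_indices r d). h \<alpha>) = (\<Sum>k<?R. h (multi_indices r d ! k))"
    for h :: "nat list \<Rightarrow> real"
    using sum.reindex_bij_betw[OF bij_betw_nth[OF distinct_multi_indices refl refl], of h r d]
    by (simp add: length_multi_indices)
  have "phi_vec n d (v + M *\<^sub>v y) = T *\<^sub>v phi_vec r d y" if "y \<in> carrier_vec r" for y
    using that
    by (intro eq_vecI)
      (auto simp: phi_vec_def T_def c sum_nth scalar_prod_def atLeast0LessThan)
  then show thesis
    by (intro that[of T]) (auto simp: T_def)
qed

theorem proposition1:
  fixes n s r :: nat and A :: "real vec set" and X :: "real mat"
  assumes "n \<ge> 1" and "s \<ge> 1"
    and "affine_subspace n r A"
    and "X \<in> carrier_mat n s"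
    and "set (cols X) \<subseteq> A"
  shows "\<forall>d\<ge>1. vec_space.rank ((n + d) choose d) (phi_mat n d X) \<le> (r + d) choose d"
proof (intro allI impI)
  fix d :: nat
  obtain v M where v: "v \<in> carrier_vec n" and M: "M \<in> carrier_mat n r"
    and A: "\<And>x. x \<in> A \<Longrightarrow> \<exists>y\<in>carrier_vec r. x = v + M *\<^sub>v y"
    using affine_subspace_parametrization[OF assms(3)] by metis
  obtain T where T: "T \<in> carrier_mat ((n + d) choose d) ((r + d) choose d)"
    and phi: "\<And>y. y \<in> carrier_vec r \<Longrightarrow> phi_vec n d (v + M *\<^sub>v y) = T *\<^sub>v phi_vec r d y"
    using phi_vec_affine[OF M v] by metis
  have cols: "cols (phi_mat n d X) = map (phi_vec n d) (cols X)"
    unfolding phi_mat_def by (intro cols_mat_of_cols) (auto simp: phi_vec_def)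
  show "vec_space.rank ((n + d) choose d) (phi_mat n d X) \<le> (r + d) choose d"
  proof (rule vec_space.rank_le_dim_col_factor[OF _ T])
    show "phi_mat n d X \<in> carrier_mat ((n + d) choose d) s"
      using assms(4) mat_of_cols_carrier(1)[of _ "map (phi_vec n d) (cols X)"]
      by (simp add: phi_mat_def)
    fix a
    assume "a \<in> set (cols (phi_mat n d X))"
    then obtain x where "x \<in> A" "a = phi_vec n d x"
      using cols assms(5) by auto
    \<comment> \<open>Here \<open>y\<close> holds affine coordinates of \<open>x\<close>, and its
      vector of monomials is the witness for the column.\<close>
    then obtain y where "y \<in> carrier_vec r" "a = T *\<^sub>v phi_vec r d y"
      using A phi by metis
    moreover have "phi_vec r d y \<in> carrier_vec ((r + d) choose d)"
      by (simp add: phi_vec_def)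
    ultimately show "\<exists>y\<in>carrier_vec ((r + d) choose d). a = T *\<^sub>v y"
      by blast
  qed
qed

end
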